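(* Let $(\mathbf Y,\mathcal P)$ be a happi space and $A\in\mathcal L(\mathbf Y,\mathcal P)$. Then $$\mu(A)=\|(A+\mathcal K(\mathbf Y,\mathcal P))^{-1}\|^{-1}.$$ Moreover, if $\mu(A)>0$, then $\tilde\mu(A)=\tilde\mu(A^* )$.
   Context: A happi space is a pair $(\mathbf Y,\mathcal P)$ of a complex Hilbert space $\mathbf Y$ and a sequence $\mathcal P=(P_n)_{n\in\mathbb N}$ of nested orthogonal projections, i.e. $P_n=P_n^*=P_n^2=P_nP_{n+1}=P_{n+1}P_n$, such that, with $Q_n:=I-P_n$, $\|P_n\|=\|Q_n\|=1$ for all $n$, and $\sup_n\|P_nx\|\ge\|x\|$ for all $x\in\mathbf Y$. $\mathcal K(\mathbf Y,\mathcal P):=\{K\in\mathcal L(\mathbf Y):\|Q_nK\|+\|KQ_n\|\to0\}$; $\mathcal L(\mathbf Y,\mathcal P):=\{A\in\mathcal L(\mathbf Y):AK,KA\in\mathcal K(\mathbf Y,\mathcal P)\ \forall K\in\mathcal K(\mathbf Y,\mathcal P)\}$, a closed subalgebra of $\mathcal L(\mathbf Y)$ containing $\mathcal K(\mathbf Y,\mathcal P)$ as a closed two-sided ideal. The inverse of the coset $A+\mathcal K(\mathbf Y,\mathcal P)$ and its norm are taken in $\mathcal L(\mathbf Y,\mathcal P)/\mathcal K(\mathbf Y,\mathcal P)$; convention: $\|b^{-1}\|^{-1}:=0$ if $b$ is not invertible. Lower norm: $\nu(B):=\inf\{\|Bx\|:\|x\|=1\}$. $\tilde\mu(A):=\lim_{m\to\infty}\nu(A|_{\mathrm{im}\,Q_m})$,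 with $A|_{\mathrm{im}\,Q_m}:\mathrm{im}\,Q_m\to\mathbf Y$ (limit exists by monotonicity), $\tilde\mu(A^* )$ is defined likewise for the adjoint $A^*$, and $\mu(A):=\min\{\tilde\mu(A),\tilde\mu(A^* )\}$. *)

theory Defs
  imports "HOL-Analysis.Analysis" "HOL-Algebra.QuotRing"
begin

text \<open>
  Complex Hilbert spaces. The real inner product inherited from \<^class>\<open>real_inner\<close> is required to be
  the real part of the sesquilinear form, so positive definiteness and
  \<open>norm x = sqrt (Re (cinner x x))\<close> are inherited from that class. The form is linear in its
  first argument.
\<close>

class complex_inner = real_inner +
  fixes scaleC :: "complex \<Rightarrow> 'a \<Rightarrow> 'a"  (infixr \<open>*\<^sub>C\<close> 75)
    and cinner :: "'a \<Rightarrow> 'a \<Rightarrow> complex"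
  assumes scaleC_add_right: "c *\<^sub>C (x + y) = c *\<^sub>C x + c *\<^sub>C y"
    and scaleC_add_left: "(c + d) *\<^sub>C x = c *\<^sub>C x + d *\<^sub>C x"
    and scaleC_scaleC: "c *\<^sub>C d *\<^sub>C x = (c * d) *\<^sub>C x"
    and scaleC_of_real: "complex_of_real r *\<^sub>C x = r *\<^sub>R x"
    and cinner_commute: "cinner x y = cnj (cinner y x)"
    and cinner_add_left: "cinner (x + y) z = cinner x z + cinner y z"
    and cinner_scaleC_left: "cinner (c *\<^sub>C x) y = c * cinner x y"
    and inner_eq_Re_cinner: "inner x y = Re (cinner x y)"

class complex_hilbert_space = complex_inner + complete_space

instantiation complex :: complex_hilbert_space
begin

definition scaleC_complex :: "complex \<Rightarrow> complex \<Rightarrow> complex"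
  where "scaleC_complex c x = c * x"

definition cinner_complex :: "complex \<Rightarrow> complex \<Rightarrow> complex"
  where "cinner_complex x y = x * cnj y"

instance
  by standard
    (auto simp: scaleC_complex_def cinner_complex_def algebra_simps scaleR_conv_of_real
       inner_complex_def)

end

text \<open>
  Elements of \<^typ>\<open>'a \<Rightarrow>\<^sub>L 'a\<close> are only real-linear; the bounded operators of a complex Hilbert
  space are the complex-homogeneous ones. Both notions carry the same operator norm.
\<close>

definition bounded_ops :: "('a::complex_hilbert_space \<Rightarrow>\<^sub>L 'a) set"
  where "bounded_ops = {A. \<forall>c x. blinfun_apply A (c *\<^sub>C x) = c *\<^sub>C blinfun_apply A x}"

definition hilbert_adjoint ::
    "('a::complex_hilbert_space \<Rightarrow>\<^sub>L 'a) \<Rightarrow> ('a \<Rightarrow>\<^sub>L 'a)"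
  where "hilbert_adjoint A =
    (THE B. B \<in> bounded_ops \<and>
      (\<forall>x y. cinner (blinfun_apply A x) y = cinner x (blinfun_apply B y)))"

definition compl_proj ::
    "(nat \<Rightarrow> ('a::complex_hilbert_space \<Rightarrow>\<^sub>L 'a)) \<Rightarrow> nat \<Rightarrow> ('a \<Rightarrow>\<^sub>L 'a)"
  where "compl_proj P n = id_blinfun - P n"

definition happi_space :: "(nat \<Rightarrow> ('a::complex_hilbert_space \<Rightarrow>\<^sub>L 'a)) \<Rightarrow> bool"
  where "happi_space P \<longleftrightarrow>
    (\<forall>n. P n \<in> bounded_ops \<and>
         P n = hilbert_adjoint (P n) \<and>
         P n = P n o\<^sub>L P n \<and>
         P n = P n o\<^sub>L P (Suc n) \<and>
         P n = P (Suc n) o\<^sub>L P n \<and>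
         norm (P n) = 1 \<and> norm (compl_proj P n) = 1) \<and>
    (\<forall>x. (SUP n. norm (blinfun_apply (P n) x)) \<ge> norm x)"

text \<open>
  \<open>compact_ops P\<close> is \<open>K(Y,P)\<close>, the operators compact relative to \<open>P\<close>, and \<open>proj_ops P\<close> is \<open>L(Y,P)\<close>.
\<close>

definition compact_ops ::
    "(nat \<Rightarrow> ('a::complex_hilbert_space \<Rightarrow>\<^sub>L 'a)) \<Rightarrow> ('a \<Rightarrow>\<^sub>L 'a) set"
  where "compact_ops P =
    {K \<in> bounded_ops.
       (\<lambda>n. norm (compl_proj P n o\<^sub>L K) + norm (K o\<^sub>L compl_proj P n)) \<longlonglongrightarrow> 0}"

definition proj_ops ::
    "(nat \<Rightarrow> ('a::complex_hilbert_space \<Rightarrow>\<^sub>L 'a)) \<Rightarrow> ('a \<Rightarrow>\<^sub>L 'a) set"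
  where "proj_ops P =
    {A \<in> bounded_ops.
       \<forall>K \<in> compact_ops P. A o\<^sub>L K \<in> compact_ops P \<and> K o\<^sub>L A \<in> compact_ops P}"

definition proj_ring ::
    "(nat \<Rightarrow> ('a::complex_hilbert_space \<Rightarrow>\<^sub>L 'a)) \<Rightarrow> ('a \<Rightarrow>\<^sub>L 'a) ring"
  where "proj_ring P =
    \<lparr>carrier = proj_ops P, mult = (o\<^sub>L), one = id_blinfun, zero = 0, add = (+)\<rparr>"

definition quot_ring ::
    "(nat \<Rightarrow> ('a::complex_hilbert_space \<Rightarrow>\<^sub>L 'a)) \<Rightarrow> ('a \<Rightarrow>\<^sub>L 'a) set ring"
  where "quot_ring P = proj_ring P Quot compact_ops P"

definition op_coset ::
    "(nat \<Rightarrow> ('a::complex_hilbert_space \<Rightarrow>\<^sub>L 'a)) \<Rightarrow> ('a \<Rightarrow>\<^sub>L 'a) \<Rightarrow> ('a \<Rightarrow>\<^sub>L 'a) set"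
  where "op_coset P A = compact_ops P +>\<^bsub>proj_ring P\<^esub> A"

text \<open>Elements of the factor ring are cosets as sets, so the quotient norm is an infimum over the coset.\<close>

definition coset_norm :: "('a::real_normed_vector) set \<Rightarrow> real"
  where "coset_norm S = (INF B\<in>S. norm B)"

text \<open>The number \<open>\<parallel>b\<^sup>-\<^sup>1\<parallel>\<^sup>-\<^sup>1\<close>, with value 0 for non-invertible \<open>b\<close>.\<close>

definition inv_norm_recip ::
    "(nat \<Rightarrow> ('a::complex_hilbert_space \<Rightarrow>\<^sub>L 'a)) \<Rightarrow> ('a \<Rightarrow>\<^sub>L 'a) set \<Rightarrow> real"
  where "inv_norm_recip P b =
    (if b \<in> Units (quot_ring P) then inverse (coset_norm (inv\<^bsub>quot_ring P\<^esub> b)) else 0)"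

definition lower_norm_on ::
    "('a::real_normed_vector) set \<Rightarrow> ('a \<Rightarrow>\<^sub>L 'b::real_normed_vector) \<Rightarrow> real"
  where "lower_norm_on S A = (INF x\<in>{x \<in> S. norm x = 1}. norm (blinfun_apply A x))"

definition mu_tilde ::
    "(nat \<Rightarrow> ('a::complex_hilbert_space \<Rightarrow>\<^sub>L 'a)) \<Rightarrow> ('a \<Rightarrow>\<^sub>L 'a) \<Rightarrow> real"
  where "mu_tilde P A = lim (\<lambda>m. lower_norm_on (range (blinfun_apply (compl_proj P m))) A)"

definition mu ::
    "(nat \<Rightarrow> ('a::complex_hilbert_space \<Rightarrow>\<^sub>L 'a)) \<Rightarrow> ('a \<Rightarrow>\<^sub>L 'a) \<Rightarrow> real"
  where "mu P A = min (mu_tilde P A) (mu_tilde P (hilbert_adjoint A))"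

end

theory Submission
  imports Defs
begin

text \<open>
  Write \<open>Q n\<close> for the complementary projections and call the elements of \<open>compact_ops P\<close> relatively
  compact. If \<open>A\<close> is invertible modulo the relatively compact operators, with inverse the coset of
  \<open>B\<close>, then \<open>mu_tilde P A\<close> is exactly the reciprocal of the norm of that coset.

  For every representative \<open>B\<close> the operator \<open>B A - 1\<close> is negligible on the range of \<open>Q m\<close> for large
  \<open>m\<close>, so \<open>A\<close> is bounded below there by nearly \<open>1 / norm B\<close> (\<open>mu_tilde_lower_bound\<close>). Conversely,
  the representatives \<open>Q m B Q n\<close> satisfy \<open>A Q m B Q n \<approx> Q n\<close> for \<open>n\<close> large compared with \<open>m\<close>, and
  \<open>A\<close> multiplies norms on the range of \<open>Q m\<close> by at least about \<open>mu_tilde P A\<close>; so these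
  representatives have norm at most about \<open>1 / mu_tilde P A\<close> (\<open>coset_norm_upper_bound\<close>). The adjoint
  is an isometry that preserves both algebras, so \<open>mu_tilde\<close> of the adjoint is the reciprocal of the
  same norm.

  It remains to see that \<open>A\<close> is invertible modulo the relatively compact operators as soon as both
  numbers are positive (\<open>two_sided_inverse_mod_compact_ops\<close>). Positivity of \<open>mu_tilde P A\<close> bounds \<open>A\<close>
  from below on the range of some \<open>Q m\<close>, so that \<open>Q m A\<^sup>* A Q m + P m\<close> is coercive. It is congruent
  to \<open>A\<^sup>* A\<close> modulo the relatively compact operators, and its inverse, a Neumann series, lies in the
  norm-closed algebra \<open>proj_ops P\<close>. This gives a left inverse of \<open>A\<close> in the quotient; the same
  argument for the adjoint gives a right inverse.
\<close>

section \<open>Complex Hilbert spaces and adjoints\<close>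

lemma cinner_scaleC_right: "cinner x (c *\<^sub>C y) = cnj c * cinner (x::'a::complex_inner) y"
  by (metis cinner_commute cinner_scaleC_left complex_cnj_mult)

lemma inner_scaleC_left: "inner (c *\<^sub>C x) y = inner (x::'a::complex_inner) (cnj c *\<^sub>C y)"
  by (simp add: inner_eq_Re_cinner cinner_scaleC_left cinner_scaleC_right)

lemma cinner_eq_Complex:
  "cinner x y = Complex (inner x y) (inner x (\<i> *\<^sub>C (y::'a::complex_inner)))"
  by (simp add: inner_eq_Re_cinner cinner_scaleC_right complex_eq_iff)

lemma norm_scaleC: "norm (c *\<^sub>C (x::'a::complex_inner)) = cmod c * norm x"
proof -
  have "inner (c *\<^sub>C x) (c *\<^sub>C x) = Re ((c * cnj c) * cinner x x)"
    by (simp add: inner_eq_Re_cinner cinner_scaleC_left cinner_scaleC_right algebra_simps)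
  also have "\<dots> = (cmod c)\<^sup>2 * inner x x"
    by (simp add: inner_eq_Re_cinner flip: complex_norm_square)
  finally show ?thesis
    by (simp add: norm_eq_sqrt_inner real_sqrt_mult)
qed

lemma bounded_linear_scaleC: "bounded_linear (\<lambda>x::'a::complex_inner. c *\<^sub>C x)"
proof (rule bounded_linear_intro[where K = "cmod c"])
  show "c *\<^sub>C r *\<^sub>R x = r *\<^sub>R c *\<^sub>C x" for r and x :: 'a
    by (metis scaleC_of_real scaleC_scaleC mult.commute)
qed (auto simp: scaleC_add_right norm_scaleC)

text \<open>
  The representing vector minimises the functional \<open>\<parallel>x\<parallel>\<^sup>2 - 2 f x\<close>. By the parallelogram law a
  minimising sequence is Cauchy, and a minimiser has vanishing directional derivatives.
\<close>

lemma riesz_representation: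
  fixes f :: "'a::{real_inner, complete_space} \<Rightarrow> real"
  assumes f: "bounded_linear f"
  shows "\<exists>z. \<forall>x. f x = inner x z"
proof -
  interpret f: bounded_linear f by (fact f)
  define J where "J x = inner x x - 2 * f x" for x
  obtain K where K: "\<And>x. norm (f x) \<le> norm x * K"
    using f.bounded by blast
  have below: "- K\<^sup>2 \<le> J x" for x
  proof -
    have "0 \<le> (norm x - K)\<^sup>2" by simp
    then show ?thesis
      using K[of x] by (simp add: J_def power2_eq_square algebra_simps flip: power2_norm_eq_inner)
  qed
  define d where "d = (INF x. J x)"
  have bdd: "bdd_below (range J)"
    using below by (auto simp: bdd_below_def)
  have d_le: "d \<le> J x" for x
    unfolding d_def by (rule cINF_lower[OF bdd]) simp
  have "\<exists>x. J x < d + inverse (real (Suc n))" for n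
  proof -
    have "Inf (range J) < d + inverse (real (Suc n))" by (simp add: d_def)
    from cInf_lessD[OF _ this] show ?thesis by blast
  qed
  then obtain X where X: "\<And>n. J (X n) < d + inverse (real (Suc n))"
    by metis
  have parallelogram: "(norm (x - y))\<^sup>2 = 2 * J x + 2 * J y - 4 * J ((1/2) *\<^sub>R (x + y))" for x y
    by (simp add: J_def power2_norm_eq_inner inner_commute f.scaleR f.add f.diff algebra_simps)
  have close: "(norm (X m - X n))\<^sup>2 \<le> 2 * inverse (real (Suc m)) + 2 * inverse (real (Suc n))" for m n
    using parallelogram[of "X m" "X n"] X[of m] X[of n] d_le[of "(1/2) *\<^sub>R (X m + X n)"] by linarith
  have "Cauchy X"
  proof (rule metric_CauchyI)
    fix e :: real assume "0 < e"
    then obtain M where M: "inverse (real (Suc M)) < e\<^sup>2 / 4"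
      using reals_Archimedean[of "e\<^sup>2 / 4"] by auto
    have "dist (X m) (X n) < e" if "M \<le> m" "M \<le> n" for m n
    proof -
      have "inverse (real (Suc m)) \<le> inverse (real (Suc M))"
           "inverse (real (Suc n)) \<le> inverse (real (Suc M))"
        using that by (auto intro!: le_imp_inverse_le)
      with close[of m n] M have "(norm (X m - X n))\<^sup>2 < e\<^sup>2" by linarith
      then show ?thesis
        using \<open>0 < e\<close> by (simp add: dist_norm power_less_imp_less_base)
    qed
    then show "\<exists>M. \<forall>m\<ge>M. \<forall>n\<ge>M. dist (X m) (X n) < e" by blast
  qed
  then obtain z where z: "X \<longlonglongrightarrow> z"
    using Cauchy_convergent convergent_def by blast
  have "(\<lambda>n. J (X n)) \<longlonglongrightarrow> J z"
    unfolding J_def by (intro tendsto_intros f.tendsto z)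
  moreover have "(\<lambda>n. d + inverse (real (Suc n))) \<longlonglongrightarrow> d + 0"
    by (intro tendsto_intros LIMSEQ_inverse_real_of_nat)
  ultimately have "J z \<le> d + 0"
    by (rule LIMSEQ_le) (blast intro: less_imp_le X)
  then have min: "J z \<le> J x" for x
    using d_le[of x] by simp
  have "f v = inner v z" for v
  proof -
    define a where "a = inner z v - f v"
    define b where "b = inner v v"
    have b: "0 \<le> b" by (simp add: b_def)
    have quad: "0 \<le> 2 * t * a + t\<^sup>2 * b" for t
      using min[of "z + t *\<^sub>R v"]
      by (simp add: J_def a_def b_def f.add f.scaleR inner_commute power2_eq_square algebra_simps)
    \<comment> \<open>Nearly the minimiser \<open>- a / b\<close> of the quadratic, but defined for \<open>b = 0\<close> too.\<close>
    define t where "t = - a / (b + 1)"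
    have a: "a = - (t * (b + 1))"
      using b by (simp add: t_def)
    have "t\<^sup>2 * (b + 2) \<le> 0"
      using quad[of t] by (simp add: a power2_eq_square algebra_simps)
    with a b have "a = 0"
      by (auto simp: mult_le_0_iff)
    then show ?thesis by (simp add: a_def inner_commute)
  qed
  then show ?thesis by blast
qed

lemma bounded_opsD: "A \<in> bounded_ops \<Longrightarrow> A (c *\<^sub>C x) = c *\<^sub>C A x"
  by (simp add: bounded_ops_def)

lemma bounded_ops_zero: "0 \<in> bounded_ops"
  using bounded_linear.axioms(1)[OF bounded_linear_scaleC, THEN linear_0]
  by (auto simp: bounded_ops_def)

lemma bounded_ops_id: "id_blinfun \<in> bounded_ops"
  by (simp add: bounded_ops_def)

lemma bounded_ops_add: "A \<in> bounded_ops \<Longrightarrow> B \<in> bounded_ops \<Longrightarrow> A + B \<in> bounded_ops"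
  by (simp add: bounded_ops_def blinfun.add_left scaleC_add_right)

lemma bounded_ops_scaleR: "A \<in> bounded_ops \<Longrightarrow> r *\<^sub>R A \<in> bounded_ops"
  by (simp add: bounded_ops_def blinfun.scaleR_left
      linear_scale[OF bounded_linear.linear[OF bounded_linear_scaleC]])

lemma bounded_ops_diff: "A \<in> bounded_ops \<Longrightarrow> B \<in> bounded_ops \<Longrightarrow> A - B \<in> bounded_ops"
  using bounded_ops_add[of A "- B"] bounded_ops_scaleR[of B "- 1"] by simp

lemma bounded_ops_compose: "A \<in> bounded_ops \<Longrightarrow> B \<in> bounded_ops \<Longrightarrow> A o\<^sub>L B \<in> bounded_ops"
  by (simp add: bounded_ops_def)

lemma closed_bounded_ops: "closed (bounded_ops :: ('a::complex_hilbert_space \<Rightarrow>\<^sub>L 'a) set)"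
proof -
  have "bounded_ops = (\<Inter>c. \<Inter>x. {A :: 'a \<Rightarrow>\<^sub>L 'a. A (c *\<^sub>C x) = c *\<^sub>C A x})"
    by (auto simp: bounded_ops_def)
  also have "closed \<dots>"
    by (intro closed_INT ballI closed_Collect_eq continuous_intros
        bounded_linear.continuous_on[OF bounded_linear_scaleC])
  finally show ?thesis .
qed

text \<open>
  The description defining \<open>hilbert_adjoint\<close> is satisfied because the Riesz theorem for the real
  inner product represents \<open>x \<mapsto> inner (A x) y\<close>. Complex linearity of \<open>A\<close> makes the representing
  vector depend complex-linearly on \<open>y\<close>, and by \<open>cinner_eq_Complex\<close> the real adjoint identity
  determines the complex one. From here on the real inner product suffices.
\<close>

lemma hilbert_adjoint_characterization:
  fixes A :: "'a::complex_hilbert_space \<Rightarrow>\<^sub>L 'a"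
  assumes A: "A \<in> bounded_ops"
  shows "hilbert_adjoint A \<in> bounded_ops"
    and "inner (A x) y = inner x (hilbert_adjoint A y)"
proof -
  have "\<exists>z. \<forall>x. inner (A x) y = inner x z" for y
    by (rule riesz_representation) (intro bounded_linear_intros)
  then obtain G where G: "\<And>x y. inner (A x) y = inner x (G y)"
    by metis
  have ext: "u = v" if "\<And>x. inner x u = inner x v" for u v :: 'a
    using that[of "u - v"] by (metis inner_diff_right inner_eq_zero_iff right_minus_eq)
  have "bounded_linear G"
  proof (rule bounded_linear_intro)
    show "G (x + y) = G x + G y" for x y
      by (rule ext) (simp add: inner_add_right flip: G)
    show "G (r *\<^sub>R x) = r *\<^sub>R G x" for r x
      by (rule ext) (simp flip: G)
    show "norm (G y) \<le> norm y * norm A" for y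
    proof -
      have "norm (G y) * norm (G y) = inner (A (G y)) y"
        by (simp add: G power2_norm_eq_inner flip: power2_eq_square)
      also have "\<dots> \<le> norm (A (G y)) * norm y" by (rule norm_cauchy_schwarz)
      also have "\<dots> \<le> norm (G y) * (norm y * norm A)"
        using mult_right_mono[OF norm_blinfun[of A "G y"] norm_ge_zero[of y]]
        by (simp add: mult_ac)
      finally show ?thesis
        by (cases "G y = 0") auto
    qed
  qed
  then have apply_G: "Blinfun G y = G y" for y
    by (simp add: bounded_linear_Blinfun_apply)
  have G_scaleC: "G (c *\<^sub>C y) = c *\<^sub>C G y" for c y
  proof (rule ext)
    fix x
    have "inner x (G (c *\<^sub>C y)) = inner (cnj c *\<^sub>C A x) y"
      by (simp add: inner_scaleC_left flip: G)
    also have "\<dots> = inner (cnj c *\<^sub>C x) (G y)"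
      by (simp add: G flip: bounded_opsD[OF A])
    finally show "inner x (G (c *\<^sub>C y)) = inner x (c *\<^sub>C G y)"
      by (simp add: inner_scaleC_left)
  qed
  have "hilbert_adjoint A = Blinfun G"
    unfolding hilbert_adjoint_def
  proof (rule the_equality)
    show "Blinfun G \<in> bounded_ops \<and> (\<forall>x y. cinner (A x) y = cinner x (Blinfun G y))"
      by (simp add: bounded_ops_def apply_G G_scaleC cinner_eq_Complex G)
  next
    fix B assume B: "B \<in> bounded_ops \<and> (\<forall>x y. cinner (A x) y = cinner x (blinfun_apply B y))"
    show "B = Blinfun G"
    proof (rule blinfun_eqI, unfold apply_G, rule ext)
      fix x y
      show "inner x (B y) = inner x (G y)"
        unfolding G[symmetric] using B by (simp add: inner_eq_Re_cinner)
    qed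
  qed
  then show "hilbert_adjoint A \<in> bounded_ops" "inner (A x) y = inner x (hilbert_adjoint A y)"
    by (simp_all add: apply_G bounded_ops_def G_scaleC G)
qed

lemma hilbert_adjoint_unique:
  fixes A B :: "'a::complex_hilbert_space \<Rightarrow>\<^sub>L 'a"
  assumes "A \<in> bounded_ops" and B: "\<And>x y. inner (A x) y = inner x (B y)"
  shows "hilbert_adjoint A = B"
proof (rule blinfun_eqI)
  fix y
  have "inner x (hilbert_adjoint A y - B y) = 0" for x
    using B hilbert_adjoint_characterization(2)[OF assms(1)] by (simp add: inner_diff_right)
  from this[of "hilbert_adjoint A y - B y"] show "hilbert_adjoint A y = B y" by simp
qed

lemma hilbert_adjoint_involution:
  assumes "A \<in> bounded_ops" shows "hilbert_adjoint (hilbert_adjoint A) = A"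
  by (rule hilbert_adjoint_unique)
    (use hilbert_adjoint_characterization[OF assms] in \<open>auto simp: inner_commute\<close>)

lemma hilbert_adjoint_compose:
  assumes "A \<in> bounded_ops" "B \<in> bounded_ops"
  shows "hilbert_adjoint (A o\<^sub>L B) = hilbert_adjoint B o\<^sub>L hilbert_adjoint A"
  by (rule hilbert_adjoint_unique)
    (use assms in \<open>auto simp: bounded_ops_compose hilbert_adjoint_characterization(2)\<close>)

lemma hilbert_adjoint_diff:
  assumes "A \<in> bounded_ops" "B \<in> bounded_ops"
  shows "hilbert_adjoint (A - B) = hilbert_adjoint A - hilbert_adjoint B"
  by (rule hilbert_adjoint_unique)
    (use assms in \<open>auto simp: bounded_ops_diff blinfun.diff_left inner_simps
       hilbert_adjoint_characterization(2)\<close>)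

lemma hilbert_adjoint_id: "hilbert_adjoint id_blinfun = id_blinfun"
  by (rule hilbert_adjoint_unique) (auto simp: bounded_ops_id)

lemma norm_hilbert_adjoint:
  assumes "A \<in> bounded_ops"
  shows "norm (hilbert_adjoint A) = norm A"
proof -
  have "norm (hilbert_adjoint B) \<le> norm B" if B: "B \<in> bounded_ops" for B :: "'a \<Rightarrow>\<^sub>L 'a"
  proof (rule norm_blinfun_bound)
    fix y
    let ?w = "hilbert_adjoint B y"
    have "norm ?w * norm ?w = inner (B ?w) y"
      by (simp add: hilbert_adjoint_characterization(2)[OF B] power2_norm_eq_inner
          flip: power2_eq_square)
    also have "\<dots> \<le> norm (B ?w) * norm y" by (rule norm_cauchy_schwarz)
    also have "\<dots> \<le> norm B * norm ?w * norm y"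
      by (intro mult_right_mono norm_blinfun norm_ge_zero)
    finally show "norm ?w \<le> norm B * norm y"
      by (cases "?w = 0") (auto simp: algebra_simps)
  qed simp
  from this[OF assms] this[OF hilbert_adjoint_characterization(1)[OF assms]] show ?thesis
    by (simp add: hilbert_adjoint_involution assms)
qed

text \<open>
  This makes the space of bounded operators complete in the operator norm.
\<close>

instance complex_hilbert_space \<subseteq> banach ..

section \<open>The algebra relative to a sequence of projections\<close>

lemmas compose_simps = bounded_bilinear.add_left[OF bounded_bilinear_blinfun_compose]
  bounded_bilinear.add_right[OF bounded_bilinear_blinfun_compose]
  bounded_bilinear.diff_left[OF bounded_bilinear_blinfun_compose]
  bounded_bilinear.diff_right[OF bounded_bilinear_blinfun_compose]
  bounded_bilinear.scaleR_left[OF bounded_bilinear_blinfun_compose]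
  bounded_bilinear.scaleR_right[OF bounded_bilinear_blinfun_compose]
  bounded_bilinear.minus_left[OF bounded_bilinear_blinfun_compose]
  bounded_bilinear.minus_right[OF bounded_bilinear_blinfun_compose]

lemma compose_assoc: "(A o\<^sub>L B) o\<^sub>L C = A o\<^sub>L (B o\<^sub>L C)"
  by (rule blinfun_eqI) simp

lemma compose_id: "A o\<^sub>L id_blinfun = A" "id_blinfun o\<^sub>L A = A"
  by (rule blinfun_eqI, simp)+

locale happi =
  fixes P :: "nat \<Rightarrow> ('a::complex_hilbert_space \<Rightarrow>\<^sub>L 'a)"
  assumes happi_space: "happi_space P"
begin

abbreviation Q :: "nat \<Rightarrow> ('a \<Rightarrow>\<^sub>L 'a)"
  where "Q \<equiv> compl_proj P"

lemma P_bounded_ops: "P n \<in> bounded_ops"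
  and P_adjoint: "hilbert_adjoint (P n) = P n"
  and norm_Q: "norm (Q n) = 1"
  using happi_space unfolding happi_space_def by simp_all

lemma P_idem: "P n (P n x) = P n x"
  and P_P_Suc: "P n (P (Suc n) x) = P n x"
  and P_Suc_P: "P (Suc n) (P n x) = P n x"
proof -
  have "P n = P n o\<^sub>L P n" "P n = P n o\<^sub>L P (Suc n)" "P n = P (Suc n) o\<^sub>L P n"
    using happi_space unfolding happi_space_def by blast+
  then show "P n (P n x) = P n x" "P n (P (Suc n) x) = P n x" "P (Suc n) (P n x) = P n x"
    by (simp_all flip: blinfun_apply_blinfun_compose)
qed

lemma Q_apply: "Q n x = x - P n x"
  by (simp add: compl_proj_def blinfun.diff_left)

lemma Q_bounded_ops: "Q n \<in> bounded_ops"
  by (simp add: compl_proj_def bounded_ops_diff bounded_ops_id P_bounded_ops)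

lemma Q_adjoint: "hilbert_adjoint (Q n) = Q n"
  by (simp add: compl_proj_def hilbert_adjoint_diff bounded_ops_id P_bounded_ops
      hilbert_adjoint_id P_adjoint)

lemma Q_idem: "Q n (Q n x) = Q n x"
  by (simp add: Q_apply blinfun.diff_right P_idem)

lemma P_P_le: "m \<le> n \<Longrightarrow> P m (P n x) = P m x"
proof (induction n arbitrary: x rule: dec_induct)
  case (step n)
  have "P m (P (Suc n) x) = P m (P n (P (Suc n) x))"
    by (rule step.IH[symmetric])
  then show ?case
    by (simp add: P_P_Suc step.IH)
qed (rule P_idem)

lemma P_le_P: "m \<le> n \<Longrightarrow> P n (P m x) = P m x"
proof (induction n rule: dec_induct)
  case (step n)
  have "P (Suc n) (P n (P m x)) = P n (P m x)"
    by (rule P_Suc_P)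
  then show ?case
    by (simp only: step.IH)
qed (rule P_idem)

lemma Q_Q_le: "m \<le> n \<Longrightarrow> Q m (Q n x) = Q n x"
  by (simp add: Q_apply blinfun.diff_right P_P_le)

lemma norm_Q_le: "norm (Q n x) \<le> norm x"
  using norm_blinfun[of "Q n" x] by (simp add: norm_Q)

lemma compact_ops_iff:
  "K \<in> compact_ops P \<longleftrightarrow> K \<in> bounded_ops \<and>
     (\<lambda>n. norm (Q n o\<^sub>L K)) \<longlonglongrightarrow> 0 \<and> (\<lambda>n. norm (K o\<^sub>L Q n)) \<longlonglongrightarrow> 0"
proof -
  have "(\<lambda>n. norm (Q n o\<^sub>L K)) \<longlonglongrightarrow> 0 \<and> (\<lambda>n. norm (K o\<^sub>L Q n)) \<longlonglongrightarrow> 0"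
    if "(\<lambda>n. norm (Q n o\<^sub>L K) + norm (K o\<^sub>L Q n)) \<longlonglongrightarrow> 0"
    by (intro conjI tendsto_sandwich[OF _ _ tendsto_const that]) auto
  moreover have "(\<lambda>n. norm (Q n o\<^sub>L K) + norm (K o\<^sub>L Q n)) \<longlonglongrightarrow> 0"
    if "(\<lambda>n. norm (Q n o\<^sub>L K)) \<longlonglongrightarrow> 0" "(\<lambda>n. norm (K o\<^sub>L Q n)) \<longlonglongrightarrow> 0"
    using tendsto_add[OF that] by simp
  ultimately show ?thesis
    unfolding compact_ops_def by blast
qed

lemma compact_ops_bounded_ops: "K \<in> compact_ops P \<Longrightarrow> K \<in> bounded_ops"
  by (simp add: compact_ops_iff)

lemma compact_ops_zero: "0 \<in> compact_ops P"
  by (simp add: compact_ops_iff bounded_ops_zero)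

lemma compact_ops_add:
  assumes "K \<in> compact_ops P" "L \<in> compact_ops P"
  shows "K + L \<in> compact_ops P"
proof -
  have "(\<lambda>n. norm (Q n o\<^sub>L (K + L))) \<longlonglongrightarrow> 0" "(\<lambda>n. norm ((K + L) o\<^sub>L Q n)) \<longlonglongrightarrow> 0"
    unfolding compose_simps tendsto_norm_zero_iff
    using assms by (auto simp: compact_ops_iff tendsto_norm_zero_iff intro!: tendsto_add_zero)
  with assms show ?thesis
    by (simp add: compact_ops_iff bounded_ops_add)
qed

lemma compact_ops_scaleR:
  assumes "K \<in> compact_ops P"
  shows "r *\<^sub>R K \<in> compact_ops P"
  using assms
  by (auto simp: compact_ops_iff compose_simps bounded_ops_scaleR intro!: tendsto_mult_right_zero)

lemma compact_ops_diff:
  "K \<in> compact_ops P \<Longrightarrow> L \<in> compact_ops P \<Longrightarrow> K - L \<in> compact_ops P"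
  using compact_ops_add[of K "- L"] compact_ops_scaleR[of L "- 1"] by simp

lemma compact_ops_adjoint:
  assumes K: "K \<in> compact_ops P"
  shows "hilbert_adjoint K \<in> compact_ops P"
proof -
  have bdd: "K \<in> bounded_ops"
    by (rule compact_ops_bounded_ops[OF K])
  have "norm (Q n o\<^sub>L hilbert_adjoint K) = norm (K o\<^sub>L Q n)"
       "norm (hilbert_adjoint K o\<^sub>L Q n) = norm (Q n o\<^sub>L K)" for n
    using norm_hilbert_adjoint[of "K o\<^sub>L Q n"] norm_hilbert_adjoint[of "Q n o\<^sub>L K"] bdd
    by (simp_all add: hilbert_adjoint_compose Q_adjoint Q_bounded_ops bounded_ops_compose)
  then show ?thesis
    using K hilbert_adjoint_characterization(1)[OF bdd] by (simp add: compact_ops_iff)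
qed

text \<open>
  \<open>Q n\<close> is a contraction, so replacing \<open>K\<close> by a nearby relatively compact operator changes
  \<open>Q n o\<^sub>L K\<close> and \<open>K o\<^sub>L Q n\<close> by a small amount uniformly in \<open>n\<close>.
\<close>

lemma closed_compact_ops: "closed (compact_ops P)"
  unfolding closed_sequential_limits
proof (intro allI impI)
  fix X :: "nat \<Rightarrow> ('a \<Rightarrow>\<^sub>L 'a)" and K
  assume X: "(\<forall>j. X j \<in> compact_ops P) \<and> X \<longlonglongrightarrow> K"
  have approx: "(\<lambda>n. norm (f n K)) \<longlonglongrightarrow> 0"
    if lim: "\<And>j. (\<lambda>n. norm (f n (X j))) \<longlonglongrightarrow> 0"
      and le: "\<And>n j. norm (f n K) \<le> norm (f n (X j)) + norm (K - X j)"
    for f :: "nat \<Rightarrow> ('a \<Rightarrow>\<^sub>L 'a) \<Rightarrow> ('a \<Rightarrow>\<^sub>L 'a)"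
  proof (rule LIMSEQ_I)
    fix e :: real assume "0 < e"
    then obtain j where j: "norm (X j - K) < e / 2"
      using X LIMSEQ_D[of X K "e / 2"] by auto
    obtain N where "\<forall>n\<ge>N. norm (f n (X j)) < e / 2"
      using LIMSEQ_D[OF lim[of j], of "e / 2"] \<open>0 < e\<close> by auto
    then have "norm (f n K) < e" if "n \<ge> N" for n
      using le[of n j] j that by (fastforce simp: norm_minus_commute)
    then show "\<exists>N. \<forall>n\<ge>N. norm (norm (f n K) - 0) < e" by auto
  qed
  have "norm (Q n o\<^sub>L K) \<le> norm (Q n o\<^sub>L X j) + norm (K - X j)" for n j
    using norm_triangle_ineq[of "Q n o\<^sub>L X j" "Q n o\<^sub>L (K - X j)"]
      norm_blinfun_compose[of "Q n" "K - X j"]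
    by (simp add: norm_Q compose_simps)
  then have "(\<lambda>n. norm (Q n o\<^sub>L K)) \<longlonglongrightarrow> 0"
    using X by (intro approx[of "\<lambda>n K. Q n o\<^sub>L K"]) (auto simp: compact_ops_iff)
  moreover have "norm (K o\<^sub>L Q n) \<le> norm (X j o\<^sub>L Q n) + norm (K - X j)" for n j
    using norm_triangle_ineq[of "X j o\<^sub>L Q n" "(K - X j) o\<^sub>L Q n"]
      norm_blinfun_compose[of "K - X j" "Q n"]
    by (simp add: norm_Q compose_simps)
  then have "(\<lambda>n. norm (K o\<^sub>L Q n)) \<longlonglongrightarrow> 0"
    using X by (intro approx[of "\<lambda>n K. K o\<^sub>L Q n"]) (auto simp: compact_ops_iff)
  moreover have "K \<in> bounded_ops"
    using X closed_bounded_ops compact_ops_bounded_ops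
    unfolding closed_sequential_limits by blast
  ultimately show "K \<in> compact_ops P"
    by (simp add: compact_ops_iff)
qed

lemma P_compact_ops: "P m \<in> compact_ops P"
proof -
  have "Q n o\<^sub>L P m = 0" "P m o\<^sub>L Q n = 0" if "n \<ge> m" for n
    using that by (auto intro!: blinfun_eqI simp: Q_apply blinfun.diff_right P_P_le P_le_P)
  then have "(\<lambda>n. norm (Q n o\<^sub>L P m)) \<longlonglongrightarrow> 0" "(\<lambda>n. norm (P m o\<^sub>L Q n)) \<longlonglongrightarrow> 0"
    by (auto intro!: tendsto_eventually eventually_sequentiallyI[of m])
  then show ?thesis
    by (simp add: compact_ops_iff P_bounded_ops)
qed

lemma id_notin_compact_ops: "id_blinfun \<notin> compact_ops P"
  by (auto simp: compact_ops_iff compose_id norm_Q LIMSEQ_const_iff)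

lemma proj_ops_bounded_ops: "A \<in> proj_ops P \<Longrightarrow> A \<in> bounded_ops"
  by (simp add: proj_ops_def)

lemma proj_ops_compact_left: "A \<in> proj_ops P \<Longrightarrow> K \<in> compact_ops P \<Longrightarrow> A o\<^sub>L K \<in> compact_ops P"
  and proj_ops_compact_right: "A \<in> proj_ops P \<Longrightarrow> K \<in> compact_ops P \<Longrightarrow> K o\<^sub>L A \<in> compact_ops P"
  by (simp_all add: proj_ops_def)

lemma proj_ops_id: "id_blinfun \<in> proj_ops P"
  by (simp add: proj_ops_def bounded_ops_id compose_id)

lemma proj_ops_add: "A \<in> proj_ops P \<Longrightarrow> B \<in> proj_ops P \<Longrightarrow> A + B \<in> proj_ops P"
  by (simp add: proj_ops_def bounded_ops_add compact_ops_add compose_simps)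

lemma proj_ops_scaleR: "A \<in> proj_ops P \<Longrightarrow> r *\<^sub>R A \<in> proj_ops P"
  by (simp add: proj_ops_def bounded_ops_scaleR compact_ops_scaleR compose_simps)

lemma proj_ops_diff: "A \<in> proj_ops P \<Longrightarrow> B \<in> proj_ops P \<Longrightarrow> A - B \<in> proj_ops P"
  by (simp add: proj_ops_def bounded_ops_diff compact_ops_diff compose_simps)

lemma proj_ops_compose: "A \<in> proj_ops P \<Longrightarrow> B \<in> proj_ops P \<Longrightarrow> A o\<^sub>L B \<in> proj_ops P"
  by (simp add: proj_ops_def bounded_ops_compose compose_assoc)
    (simp flip: compose_assoc)

lemma proj_ops_adjoint:
  assumes A: "A \<in> proj_ops P"
  shows "hilbert_adjoint A \<in> proj_ops P"
proof -
  have bdd: "A \<in> bounded_ops"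
    by (rule proj_ops_bounded_ops[OF A])
  have "hilbert_adjoint A o\<^sub>L K \<in> compact_ops P \<and> K o\<^sub>L hilbert_adjoint A \<in> compact_ops P"
    if K: "K \<in> compact_ops P" for K
  proof -
    have "hilbert_adjoint (hilbert_adjoint K o\<^sub>L A) = hilbert_adjoint A o\<^sub>L K"
         "hilbert_adjoint (A o\<^sub>L hilbert_adjoint K) = K o\<^sub>L hilbert_adjoint A"
      using bdd compact_ops_bounded_ops[OF K]
      by (simp_all add: hilbert_adjoint_compose hilbert_adjoint_characterization(1)
          hilbert_adjoint_involution)
    then show ?thesis
      using compact_ops_adjoint[OF proj_ops_compact_right[OF A compact_ops_adjoint[OF K]]]
        compact_ops_adjoint[OF proj_ops_compact_left[OF A compact_ops_adjoint[OF K]]]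
      by simp
  qed
  then show ?thesis
    by (simp add: proj_ops_def hilbert_adjoint_characterization(1)[OF bdd])
qed

text \<open>
  Membership is, for every relatively compact \<open>K\<close>, the condition that two continuous functions of
  \<open>A\<close> take values in the closed set \<open>compact_ops P\<close>.
\<close>

lemma closed_proj_ops: "closed (proj_ops P)"
proof -
  have "closed ((\<lambda>A. A o\<^sub>L K) -` compact_ops P)" "closed ((\<lambda>A. K o\<^sub>L A) -` compact_ops P)" for K
    by (rule closed_vimage[OF closed_compact_ops], intro continuous_intros)+
  moreover have "proj_ops P = bounded_ops \<inter>
      (\<Inter>K\<in>compact_ops P. (\<lambda>A. A o\<^sub>L K) -` compact_ops P \<inter> (\<lambda>A. K o\<^sub>L A) -` compact_ops P)"
    by (auto simp: proj_ops_def)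
  ultimately show ?thesis
    by (auto intro!: closed_Int closed_INT closed_bounded_ops)
qed

lemma compact_ops_subset_proj_ops: "compact_ops P \<subseteq> proj_ops P"
proof
  fix A assume A: "A \<in> compact_ops P"
  have "K o\<^sub>L L \<in> compact_ops P" if K: "K \<in> compact_ops P" and L: "L \<in> compact_ops P" for K L
  proof -
    have "(\<lambda>n. norm (Q n o\<^sub>L (K o\<^sub>L L))) \<longlonglongrightarrow> 0"
      by (rule Lim_null_comparison[where g = "\<lambda>n. norm (Q n o\<^sub>L K) * norm L"])
        (use K in \<open>auto simp: compact_ops_iff norm_blinfun_compose intro!: tendsto_mult_left_zero
           simp flip: compose_assoc\<close>)
    moreover have "(\<lambda>n. norm ((K o\<^sub>L L) o\<^sub>L Q n)) \<longlonglongrightarrow> 0"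
      by (rule Lim_null_comparison[where g = "\<lambda>n. norm K * norm (L o\<^sub>L Q n)"])
        (use L in \<open>auto simp: compact_ops_iff norm_blinfun_compose compose_assoc
           intro!: tendsto_mult_right_zero\<close>)
    ultimately show ?thesis
      using K L by (simp add: compact_ops_iff bounded_ops_compose)
  qed
  with A show "A \<in> proj_ops P"
    by (simp add: proj_ops_def compact_ops_bounded_ops)
qed

text \<open>
  Inside the complete set \<open>proj_ops P\<close> the Neumann series is the fixed point of the contraction
  \<open>S \<mapsto> id_blinfun + S o\<^sub>L T\<close>, so the inverse does not leave the algebra.
\<close>

lemma neumann_inverse_in_proj_ops:
  assumes T: "T \<in> proj_ops P" and small: "norm T < 1"
  shows "\<exists>S\<in>proj_ops P. S o\<^sub>L (id_blinfun - T) = id_blinfun"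
proof -
  have "\<exists>!S. S \<in> proj_ops P \<and> id_blinfun + (S o\<^sub>L T) = S"
  proof (rule Banach_fix[OF _ _ norm_ge_zero small])
    show "complete (proj_ops P)"
      by (simp add: complete_eq_closed closed_proj_ops)
    show "proj_ops P \<noteq> {}"
      using T by blast
    show "(\<lambda>S. id_blinfun + (S o\<^sub>L T)) ` proj_ops P \<subseteq> proj_ops P"
      by (auto intro!: proj_ops_add proj_ops_id proj_ops_compose T)
    show "dist (id_blinfun + (R o\<^sub>L T)) (id_blinfun + (S o\<^sub>L T)) \<le> norm T * dist R S" for R S
      using norm_blinfun_compose[of "R - S" T]
      by (simp add: dist_norm compose_simps mult.commute)
  qed
  then obtain S where "S \<in> proj_ops P" "id_blinfun + (S o\<^sub>L T) = S" by blast
  then show ?thesis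
    by (intro bexI[of _ S]) (simp_all add: compose_simps compose_id algebra_simps)
qed

section \<open>Units of the quotient algebra\<close>

lemma op_coset_eq: "op_coset P A = (\<lambda>K. K + A) ` compact_ops P"
  by (auto simp: op_coset_def a_r_coset_def' proj_ring_def)

lemma ideal_compact_ops: "ideal (compact_ops P) (proj_ring P)"
proof (rule idealI)
  have "\<exists>B\<in>proj_ops P. B + A = 0" if "A \<in> proj_ops P" for A
    using proj_ops_scaleR[OF that, of "- 1"] by (intro bexI[of _ "- A"]) auto
  then have "abelian_group (proj_ring P)"
    using compact_ops_zero compact_ops_subset_proj_ops
    by (intro abelian_groupI) (auto simp: proj_ring_def proj_ops_add)
  moreover have "Group.monoid (proj_ring P)"
    by (rule monoidI) (auto simp: proj_ring_def proj_ops_compose proj_ops_id compose_id compose_assoc)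
  ultimately show ring: "ring (proj_ring P)"
    by (rule ringI) (auto simp: proj_ring_def compose_simps)
  then interpret ring "proj_ring P" .
  show "subgroup (compact_ops P) (add_monoid (proj_ring P))"
  proof (rule add.subgroupI)
    show "\<ominus>\<^bsub>proj_ring P\<^esub> K \<in> compact_ops P" if K: "K \<in> compact_ops P" for K
    proof -
      have neg: "- K \<in> compact_ops P"
        using compact_ops_scaleR[OF K, of "- 1"] by simp
      then have "\<ominus>\<^bsub>proj_ring P\<^esub> K = - K"
        using K compact_ops_subset_proj_ops
        by (intro minus_equality) (auto simp: proj_ring_def)
      with neg show ?thesis by simp
    qed
  qed (use compact_ops_subset_proj_ops compact_ops_zero in
      \<open>auto simp: proj_ring_def compact_ops_add\<close>)
qed (auto simp: proj_ring_def proj_ops_compact_left proj_ops_compact_right)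

lemma op_coset_eq_iff: "op_coset P A = op_coset P B \<longleftrightarrow> A - B \<in> compact_ops P"
proof
  assume "op_coset P A = op_coset P B"
  then have "A \<in> op_coset P B"
    using compact_ops_zero by (force simp: op_coset_eq)
  then show "A - B \<in> compact_ops P"
    by (auto simp: op_coset_eq)
next
  have sub: "op_coset P A \<subseteq> op_coset P B" if "A - B \<in> compact_ops P" for A B
  proof
    fix C assume "C \<in> op_coset P A"
    then obtain K where "K \<in> compact_ops P" "C = K + A" by (auto simp: op_coset_eq)
    then have "C = (K + (A - B)) + B" "K + (A - B) \<in> compact_ops P"
      using that by (auto intro: compact_ops_add)
    then show "C \<in> op_coset P B" unfolding op_coset_eq by (rule image_eqI)
  qed
  assume diff: "A - B \<in> compact_ops P"
  then have "B - A \<in> compact_ops P"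
    using compact_ops_scaleR[OF diff, of "- 1"] by simp
  with diff show "op_coset P A = op_coset P B"
    by (intro subset_antisym sub)
qed

lemma quot_ring_carrier: "carrier (quot_ring P) = op_coset P ` proj_ops P"
  by (auto simp: quot_ring_def FactRing_def A_RCOSETS_def' op_coset_def proj_ring_def)

lemma quot_ring_one: "\<one>\<^bsub>quot_ring P\<^esub> = op_coset P id_blinfun"
  by (simp add: quot_ring_def FactRing_def op_coset_def proj_ring_def)

lemma quot_ring_mult:
  assumes "A \<in> proj_ops P" "B \<in> proj_ops P"
  shows "op_coset P A \<otimes>\<^bsub>quot_ring P\<^esub> op_coset P B = op_coset P (A o\<^sub>L B)"
  using ideal.rcoset_mult_add[OF ideal_compact_ops, of A B] assms
  by (simp add: quot_ring_def FactRing_def op_coset_def proj_ring_def)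

lemma quot_ring_Units_iff:
  assumes A: "A \<in> proj_ops P"
  shows "op_coset P A \<in> Units (quot_ring P) \<longleftrightarrow>
    (\<exists>B\<in>proj_ops P. (B o\<^sub>L A) - id_blinfun \<in> compact_ops P \<and> (A o\<^sub>L B) - id_blinfun \<in> compact_ops P)"
  using A by (auto simp: Units_def quot_ring_carrier quot_ring_one quot_ring_mult op_coset_eq_iff)

lemma quot_ring_inv:
  assumes A: "A \<in> proj_ops P" and B: "B \<in> proj_ops P"
    and BA: "(B o\<^sub>L A) - id_blinfun \<in> compact_ops P" and AB: "(A o\<^sub>L B) - id_blinfun \<in> compact_ops P"
  shows "inv\<^bsub>quot_ring P\<^esub> (op_coset P A) = op_coset P B"
proof -
  interpret ring "quot_ring P"
    unfolding quot_ring_def by (rule ideal.quotient_is_ring[OF ideal_compact_ops])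
  show ?thesis
    by (rule inv_unique'[symmetric])
      (use assms in \<open>auto simp: quot_ring_carrier quot_ring_one quot_ring_mult op_coset_eq_iff\<close>)
qed

lemma coset_norm_le: "C - B \<in> compact_ops P \<Longrightarrow> coset_norm (op_coset P B) \<le> norm C"
proof -
  assume "C - B \<in> compact_ops P"
  then have "C \<in> op_coset P B"
    by (auto simp: op_coset_eq intro: image_eqI[of _ _ "C - B"])
  then show ?thesis
    unfolding coset_norm_def by (intro cINF_lower bdd_belowI[of _ 0]) auto
qed

lemma coset_norm_greatest:
  assumes "\<And>C. C - B \<in> compact_ops P \<Longrightarrow> c \<le> norm C"
  shows "c \<le> coset_norm (op_coset P B)"
  unfolding coset_norm_def
proof (rule cINF_greatest)
  show "op_coset P B \<noteq> {}"
    using compact_ops_zero by (auto simp: op_coset_eq)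
qed (use assms in \<open>auto simp: op_coset_eq\<close>)

lemma coset_norm_adjoint_le:
  assumes B: "B \<in> bounded_ops"
  shows "coset_norm (op_coset P (hilbert_adjoint B)) \<le> coset_norm (op_coset P B)"
proof (rule coset_norm_greatest)
  fix C assume C: "C - B \<in> compact_ops P"
  then have bdd: "C \<in> bounded_ops"
    using bounded_ops_add[OF compact_ops_bounded_ops[OF C] B] by simp
  from compact_ops_adjoint[OF C] have "hilbert_adjoint C - hilbert_adjoint B \<in> compact_ops P"
    by (simp add: hilbert_adjoint_diff bdd B)
  from coset_norm_le[OF this] show "coset_norm (op_coset P (hilbert_adjoint B)) \<le> norm C"
    by (simp add: norm_hilbert_adjoint bdd)
qed

lemma coset_norm_adjoint:
  assumes "B \<in> bounded_ops"
  shows "coset_norm (op_coset P (hilbert_adjoint B)) = coset_norm (op_coset P B)"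
  using coset_norm_adjoint_le[OF assms]
    coset_norm_adjoint_le[OF hilbert_adjoint_characterization(1)[OF assms]]
  by (simp add: hilbert_adjoint_involution assms)

section \<open>Asymptotic lower norms\<close>

abbreviation lower_tail :: "('a \<Rightarrow>\<^sub>L 'a) \<Rightarrow> nat \<Rightarrow> real"
  where "lower_tail A m \<equiv> lower_norm_on (range (Q m)) A"

lemma normalized_in_range_Q:
  assumes "Q m x \<noteq> 0"
  shows "(1 / norm (Q m x)) *\<^sub>R Q m x \<in> {x \<in> range (Q m). norm x = 1}"
proof -
  have "(1 / norm (Q m x)) *\<^sub>R Q m x = Q m ((1 / norm (Q m x)) *\<^sub>R x)"
    by (simp add: blinfun.scaleR_right)
  then have "(1 / norm (Q m x)) *\<^sub>R Q m x \<in> range (Q m)"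
    by (metis rangeI)
  with assms show ?thesis by simp
qed

lemma unit_vector_in_range_Q: "{x \<in> range (Q m). norm x = 1} \<noteq> {}"
proof -
  have "Q m \<noteq> 0"
    using norm_Q[of m] by auto
  then obtain y where "Q m y \<noteq> 0"
    using blinfun_eqI[of "Q m" 0] by auto
  then show ?thesis
    using normalized_in_range_Q by blast
qed

lemma lower_tail_mult_le:
  fixes A :: "'a \<Rightarrow>\<^sub>L 'a"
  shows "lower_tail A m * norm (Q m x) \<le> norm (A (Q m x))"
proof (cases "Q m x = 0")
  case False
  have "lower_tail A m \<le> norm (A ((1 / norm (Q m x)) *\<^sub>R Q m x))"
    unfolding lower_norm_on_def
    by (intro cINF_lower bdd_belowI[of _ 0] normalized_in_range_Q[OF False]) auto
  then show ?thesis
    using False by (simp add: blinfun.scaleR_right field_simps)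
qed simp

lemma lower_tail_greatest:
  fixes A :: "'a \<Rightarrow>\<^sub>L 'a"
  assumes "\<And>x. Q m x = x \<Longrightarrow> norm x = 1 \<Longrightarrow> c \<le> norm (A x)"
  shows "c \<le> lower_tail A m"
  unfolding lower_norm_on_def
  by (rule cINF_greatest[OF unit_vector_in_range_Q]) (auto simp: Q_idem intro!: assms)

lemma lower_tail_nonneg: "0 \<le> lower_tail A m"
  by (rule lower_tail_greatest) simp

lemma lower_tail_le_norm:
  fixes A :: "'a \<Rightarrow>\<^sub>L 'a"
  shows "lower_tail A m \<le> norm A"
proof -
  obtain x where "norm (Q m x) = 1"
    using unit_vector_in_range_Q[of m] by blast
  then show ?thesis
    using lower_tail_mult_le[of m A x] norm_blinfun[of A "Q m x"] by simp
qed

text \<open>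
  The ranges of the \<open>Q m\<close> decrease, so each infimum is taken over a subset of the previous unit
  sphere.
\<close>

lemma incseq_lower_tail: "incseq (lower_tail A)"
proof (rule incseq_def[THEN iffD2], intro allI impI)
  fix m n :: nat assume "m \<le> n"
  show "lower_tail A m \<le> lower_tail A n"
  proof (rule lower_tail_greatest)
    fix x assume x: "Q n x = x" "norm x = 1"
    then have "Q m x = x"
      using Q_Q_le[OF \<open>m \<le> n\<close>, of x] by simp
    then show "lower_tail A m \<le> norm (A x)"
      using lower_tail_mult_le[of m A x] x by simp
  qed
qed

lemma lower_tail_tendsto_mu_tilde: "lower_tail A \<longlonglongrightarrow> mu_tilde P A"
proof -
  obtain L where "lower_tail A \<longlonglongrightarrow> L"
    using incseq_convergent[OF incseq_lower_tail] lower_tail_le_norm by blast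
  then show ?thesis
    by (simp add: mu_tilde_def limI)
qed

lemma mu_tilde_nonneg: "0 \<le> mu_tilde P A"
  by (rule LIMSEQ_le_const[OF lower_tail_tendsto_mu_tilde]) (simp add: lower_tail_nonneg)

section \<open>Inverses modulo the ideal\<close>

text \<open>
  Let \<open>B o\<^sub>L A = id_blinfun + K\<close>. For a unit vector \<open>x\<close> in the range of \<open>Q m\<close> the relatively compact
  term is negligible, \<open>norm (K x) \<le> norm (K o\<^sub>L Q m)\<close>, so \<open>norm B * norm (A x)\<close> is at least
  \<open>1 - norm (K o\<^sub>L Q m)\<close>.
\<close>

lemma mu_tilde_lower_bound:
  assumes K: "(B o\<^sub>L A) - id_blinfun \<in> compact_ops P"
  shows "1 \<le> norm B * mu_tilde P A"
proof -
  define K where "K = (B o\<^sub>L A) - id_blinfun"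
  have lim: "(\<lambda>m. norm (K o\<^sub>L Q m)) \<longlonglongrightarrow> 0"
    using K by (simp add: K_def compact_ops_iff)
  have "B \<noteq> 0"
    using K id_notin_compact_ops compact_ops_scaleR[of "- id_blinfun" "- 1"] by auto
  have bound: "(1 - norm (K o\<^sub>L Q m)) / norm B \<le> lower_tail A m" for m
  proof (rule lower_tail_greatest)
    fix x assume x: "Q m x = x" "norm x = 1"
    have "x = B (A x) - (K o\<^sub>L Q m) x"
      by (simp add: K_def x blinfun.diff_left)
    then have "norm x \<le> norm (B (A x)) + norm ((K o\<^sub>L Q m) x)"
      by (metis norm_triangle_ineq4)
    also have "\<dots> \<le> norm B * norm (A x) + norm (K o\<^sub>L Q m) * norm x"
      by (intro add_mono norm_blinfun)
    finally show "(1 - norm (K o\<^sub>L Q m)) / norm B \<le> norm (A x)"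
      using x \<open>B \<noteq> 0\<close> by (simp add: field_simps)
  qed
  have "(\<lambda>m. (1 - norm (K o\<^sub>L Q m)) / norm B) \<longlonglongrightarrow> (1 - 0) / norm B"
    using \<open>B \<noteq> 0\<close> by (intro tendsto_intros lim) auto
  then have "(1 - 0) / norm B \<le> mu_tilde P A"
    by (rule LIMSEQ_le[OF _ lower_tail_tendsto_mu_tilde]) (blast intro: bound)
  then show ?thesis
    using \<open>B \<noteq> 0\<close> by (simp add: field_simps)
qed

text \<open>
  Two different cut-offs are used. The operator \<open>Q m o\<^sub>L B o\<^sub>L Q n\<close> lies in the coset of \<open>B\<close>; the
  left factor places its values where \<open>A\<close> is bounded below by \<open>lower_tail A m\<close>, and for fixed \<open>m\<close>
  the right factor makes \<open>A o\<^sub>L Q m o\<^sub>L B o\<^sub>L Q n\<close> differ from \<open>Q n\<close> by an operator whose norm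
  vanishes as \<open>n\<close> grows.
\<close>

lemma coset_norm_upper_bound:
  assumes A: "A \<in> proj_ops P" and B: "B \<in> proj_ops P"
    and AB: "(A o\<^sub>L B) - id_blinfun \<in> compact_ops P"
  shows "coset_norm (op_coset P B) * mu_tilde P A \<le> 1"
proof -
  let ?c = "coset_norm (op_coset P B)"
  have "?c * lower_tail A m \<le> 1" for m
  proof -
    define K where "K = ((A o\<^sub>L B) - id_blinfun) - (A o\<^sub>L (P m o\<^sub>L B))"
    have K: "K \<in> compact_ops P"
      unfolding K_def
      by (intro compact_ops_diff AB proj_ops_compact_left A proj_ops_compact_right B P_compact_ops)
    have bound: "?c * lower_tail A m \<le> 1 + norm (K o\<^sub>L Q n)" for n
    proof -
      define C where "C = Q m o\<^sub>L (B o\<^sub>L Q n)"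
      have "C - B = - 1 *\<^sub>R (P m o\<^sub>L B) - (B o\<^sub>L P n) + (P m o\<^sub>L B o\<^sub>L P n)"
        by (rule blinfun_eqI)
          (simp add: C_def Q_apply blinfun.bilinear_simps)
      also have "\<dots> \<in> compact_ops P"
        by (intro compact_ops_add compact_ops_diff compact_ops_scaleR proj_ops_compact_left B
            proj_ops_compact_right P_compact_ops subsetD[OF compact_ops_subset_proj_ops])
      finally have c_le: "?c \<le> norm C"
        by (rule coset_norm_le)
      have C_le: "norm C \<le> (1 + norm (K o\<^sub>L Q n)) / lower_tail A m" if pos: "0 < lower_tail A m"
      proof (rule norm_blinfun_bound)
        fix x
        have "lower_tail A m * norm (C x) \<le> norm (A (C x))"
          unfolding C_def using lower_tail_mult_le by simp
        also have "A (C x) = Q n x + (K o\<^sub>L Q n) x"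
          by (simp add: C_def K_def Q_apply blinfun.bilinear_simps)
        also have "norm \<dots> \<le> norm x + norm (K o\<^sub>L Q n) * norm x"
          by (intro norm_triangle_le add_mono norm_Q_le norm_blinfun)
        finally show "norm (C x) \<le> (1 + norm (K o\<^sub>L Q n)) / lower_tail A m * norm x"
          using pos by (simp add: field_simps)
      qed (use pos in simp)
      show ?thesis
      proof (cases "lower_tail A m = 0")
        case False
        then have pos: "0 < lower_tail A m"
          using lower_tail_nonneg[of m A] by linarith
        then have "?c * lower_tail A m \<le> norm C * lower_tail A m"
          using c_le by (simp add: mult_right_mono)
        also have "\<dots> \<le> 1 + norm (K o\<^sub>L Q n)"
          using C_le[OF pos] pos by (simp add: field_simps)
        finally show ?thesis .
      qed simp
    qed
    have "(\<lambda>n. 1 + norm (K o\<^sub>L Q n)) \<longlonglongrightarrow> 1 + 0"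
      using K by (intro tendsto_intros) (simp add: compact_ops_iff)
    then show ?thesis
      using LIMSEQ_le_const bound by fastforce
  qed
  then show ?thesis
    by (intro LIMSEQ_le_const2[OF tendsto_mult_left[OF lower_tail_tendsto_mu_tilde]]) auto
qed

text \<open>
  For a suitable \<open>t > 0\<close> the operator \<open>id_blinfun - t *\<^sub>R H\<close> has norm below 1: expanding the square,
  the cross term gains \<open>2 * t * d\<close>, which for small \<open>t\<close> exceeds the loss \<open>t\<^sup>2 * (norm H)\<^sup>2\<close>. The
  Neumann series then provides the inverse inside \<open>proj_ops P\<close>.
\<close>

lemma coercive_left_inverse:
  assumes H: "H \<in> proj_ops P" and "0 < d"
    and coercive: "\<And>x. d * (norm x)\<^sup>2 \<le> inner (H x) x"
  shows "\<exists>S\<in>proj_ops P. S o\<^sub>L H = id_blinfun"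
proof -
  \<comment> \<open>The summand \<open>d\<close> makes \<open>M\<close> positive and \<open>d / M \<le> 1\<close>; the chosen \<open>t\<close> minimises
      \<open>1 - 2 * t * d + t\<^sup>2 * M\<^sup>2\<close>, with minimum \<open>q\<close>.\<close>
  define M where "M = norm H + d"
  define t where "t = d / M\<^sup>2"
  have M: "0 < M" "d \<le> M" "norm H \<le> M"
    using \<open>0 < d\<close> by (auto simp: M_def add_nonneg_pos)
  have "0 < t"
    using M \<open>0 < d\<close> by (simp add: t_def)
  define q where "q = 1 - (d / M)\<^sup>2"
  have q: "0 \<le> q" "q < 1"
    using M \<open>0 < d\<close> by (auto simp: q_def power_le_one)
  have "norm (id_blinfun - t *\<^sub>R H) \<le> sqrt q"
  proof (rule norm_blinfun_bound)
    fix x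
    have "(norm (H x))\<^sup>2 \<le> (M * norm x)\<^sup>2"
      by (intro power_mono order_trans[OF norm_blinfun] mult_right_mono M) auto
    then have "t\<^sup>2 * (norm (H x))\<^sup>2 \<le> t\<^sup>2 * (M * norm x)\<^sup>2"
      by (rule mult_left_mono) simp
    moreover have "2 * t * (d * (norm x)\<^sup>2) \<le> 2 * t * inner (H x) x"
      using coercive \<open>0 < t\<close> by simp
    moreover have "(norm ((id_blinfun - t *\<^sub>R H) x))\<^sup>2
        = (norm x)\<^sup>2 - 2 * t * inner (H x) x + t\<^sup>2 * (norm (H x))\<^sup>2"
      by (simp add: blinfun.bilinear_simps power2_norm_eq_inner inner_commute inner_diff_left
          inner_diff_right) (simp add: power2_eq_square algebra_simps)
    moreover have "(norm x)\<^sup>2 - 2 * t * (d * (norm x)\<^sup>2) + t\<^sup>2 * (M * norm x)\<^sup>2 = q * (norm x)\<^sup>2"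
      using M by (simp add: t_def q_def field_simps power2_eq_square)
    ultimately have "(norm ((id_blinfun - t *\<^sub>R H) x))\<^sup>2 \<le> q * (norm x)\<^sup>2"
      by linarith
    from real_sqrt_le_mono[OF this] show "norm ((id_blinfun - t *\<^sub>R H) x) \<le> sqrt q * norm x"
      by (simp add: real_sqrt_mult)
  qed (use q in simp)
  also have "sqrt q < 1"
    using q by simp
  finally obtain S where S: "S \<in> proj_ops P" "S o\<^sub>L (id_blinfun - (id_blinfun - t *\<^sub>R H)) = id_blinfun"
    using neumann_inverse_in_proj_ops[of "id_blinfun - t *\<^sub>R H"] H
    by (blast intro: proj_ops_diff proj_ops_id proj_ops_scaleR)
  then show ?thesis
    by (intro bexI[of _ "t *\<^sub>R S"]) (simp_all add: compose_simps proj_ops_scaleR)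
qed

text \<open>
  On the range of \<open>Q m\<close> the operator \<open>A\<^sup>* A\<close> is bounded below. Compressing it to that range and
  adding \<open>P m\<close> on the orthogonal complement changes it only by a relatively compact operator and
  makes it coercive on the whole space. If \<open>S\<close> inverts the result from the left, then \<open>S A\<^sup>*\<close> is a
  left inverse of \<open>A\<close> modulo \<open>compact_ops P\<close>. Passing through \<open>A\<^sup>* A\<close> keeps the inverse inside
  \<open>proj_ops P\<close>.
\<close>

lemma left_inverse_mod_compact_ops:
  assumes A: "A \<in> proj_ops P" and pos: "0 < mu_tilde P A"
  shows "\<exists>B\<in>proj_ops P. (B o\<^sub>L A) - id_blinfun \<in> compact_ops P"
proof -
  obtain m where c: "0 < lower_tail A m"
    using order_tendstoD(1)[OF lower_tail_tendsto_mu_tilde pos] eventually_sequentially by auto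
  define c where "c = lower_tail A m"
  define D where "D = hilbert_adjoint A o\<^sub>L A"
  define H where "H = (Q m o\<^sub>L D o\<^sub>L Q m) + P m"
  have P: "P m \<in> proj_ops P" for m
    using P_compact_ops compact_ops_subset_proj_ops by blast
  have D: "D \<in> proj_ops P"
    unfolding D_def by (intro proj_ops_compose proj_ops_adjoint A)
  have Q: "Q m \<in> proj_ops P"
    unfolding compl_proj_def by (intro proj_ops_diff proj_ops_id P)
  have inner_adj: "inner (hilbert_adjoint A x) y = inner x (A y)" for x y
    using hilbert_adjoint_characterization(2)[OF proj_ops_bounded_ops[OF A]]
    by (simp add: inner_commute)
  have inner_Q: "inner (Q m x) y = inner x (Q m y)" for x y
    using hilbert_adjoint_characterization(2)[OF Q_bounded_ops, of m] by (simp add: Q_adjoint)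
  have inner_P: "inner (P m x) y = inner x (P m y)" for x y
    using hilbert_adjoint_characterization(2)[OF P_bounded_ops, of m] by (simp add: P_adjoint)
  have "\<exists>S\<in>proj_ops P. S o\<^sub>L H = id_blinfun"
  proof (rule coercive_left_inverse)
    show "H \<in> proj_ops P"
      unfolding H_def by (intro proj_ops_add proj_ops_compose P D Q)
    show "0 < min (c\<^sup>2) 1"
      using c by (simp add: c_def)
    fix x
    have pythagoras: "(norm x)\<^sup>2 = (norm (Q m x))\<^sup>2 + (norm (P m x))\<^sup>2"
      using inner_P[of "P m x" x] by (simp add: Q_apply power2_norm_eq_inner P_idem inner_P
          inner_commute algebra_simps)
    have "(c * norm (Q m x))\<^sup>2 \<le> (norm (A (Q m x)))\<^sup>2"
      using c by (intro power_mono) (simp_all add: c_def lower_tail_mult_le)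
    moreover have "min (c\<^sup>2) 1 * (norm (Q m x))\<^sup>2 \<le> (c * norm (Q m x))\<^sup>2"
                  "min (c\<^sup>2) 1 * (norm (P m x))\<^sup>2 \<le> (norm (P m x))\<^sup>2"
      by (auto simp: power_mult_distrib intro!: mult_right_mono mult_left_le_one_le)
    moreover have "inner (H x) x = (norm (A (Q m x)))\<^sup>2 + (norm (P m x))\<^sup>2"
      using inner_P[of "P m x" x]
      by (simp add: H_def D_def blinfun.add_left inner_add_left inner_Q inner_adj P_idem
          power2_norm_eq_inner)
    ultimately show "min (c\<^sup>2) 1 * (norm x)\<^sup>2 \<le> inner (H x) x"
      by (simp add: pythagoras distrib_left)
  qed
  then obtain S where S: "S \<in> proj_ops P" "S o\<^sub>L H = id_blinfun" by blast
  have "D - H = (P m o\<^sub>L D) + (Q m o\<^sub>L D o\<^sub>L P m) - P m"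
    by (rule blinfun_eqI) (simp add: H_def Q_apply blinfun.bilinear_simps)
  also have "\<dots> \<in> compact_ops P"
    by (intro compact_ops_add compact_ops_diff proj_ops_compact_left proj_ops_compact_right
        proj_ops_compose P_compact_ops D Q)
  finally have "S o\<^sub>L (D - H) \<in> compact_ops P"
    by (intro proj_ops_compact_left S)
  then have "((S o\<^sub>L hilbert_adjoint A) o\<^sub>L A) - id_blinfun \<in> compact_ops P"
    by (simp add: compose_simps S D_def compose_assoc)
  then show ?thesis
    by (intro bexI[of _ "S o\<^sub>L hilbert_adjoint A"]) (auto intro: proj_ops_compose S proj_ops_adjoint A)
qed

lemma mod_compact_ops_adjoint:
  assumes A: "A \<in> proj_ops P" and B: "B \<in> proj_ops P"
    and BA: "(B o\<^sub>L A) - id_blinfun \<in> compact_ops P"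
  shows "(hilbert_adjoint A o\<^sub>L hilbert_adjoint B) - id_blinfun \<in> compact_ops P"
  using compact_ops_adjoint[OF BA] proj_ops_bounded_ops[OF A] proj_ops_bounded_ops[OF B]
  by (simp add: hilbert_adjoint_diff hilbert_adjoint_compose bounded_ops_compose bounded_ops_id
      hilbert_adjoint_id)

text \<open>
  A left inverse of \<open>A\<^sup>*\<close> yields, by taking adjoints, a right inverse of \<open>A\<close>; in a quotient ring a
  left and a right inverse coincide.
\<close>

lemma two_sided_inverse_mod_compact_ops:
  assumes A: "A \<in> proj_ops P" and pos: "0 < mu_tilde P A" "0 < mu_tilde P (hilbert_adjoint A)"
  shows "\<exists>B\<in>proj_ops P. (B o\<^sub>L A) - id_blinfun \<in> compact_ops P \<and> (A o\<^sub>L B) - id_blinfun \<in> compact_ops P"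
proof -
  obtain B where B: "B \<in> proj_ops P" "(B o\<^sub>L A) - id_blinfun \<in> compact_ops P"
    using left_inverse_mod_compact_ops[OF A pos(1)] by blast
  obtain C where C: "C \<in> proj_ops P" "(C o\<^sub>L hilbert_adjoint A) - id_blinfun \<in> compact_ops P"
    using left_inverse_mod_compact_ops[OF proj_ops_adjoint[OF A] pos(2)] by blast
  define R where "R = hilbert_adjoint C"
  have R: "R \<in> proj_ops P" "(A o\<^sub>L R) - id_blinfun \<in> compact_ops P"
    using mod_compact_ops_adjoint[OF proj_ops_adjoint[OF A] C]
    by (simp_all add: R_def proj_ops_adjoint C hilbert_adjoint_involution proj_ops_bounded_ops A)
  \<comment> \<open>Modulo \<open>compact_ops P\<close> this is \<open>R A = (B A) (R A) = B (A R) A = B A = 1\<close>.\<close>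
  have "(R o\<^sub>L A) - id_blinfun = ((B o\<^sub>L A) - id_blinfun)
      + (B o\<^sub>L ((A o\<^sub>L R) - id_blinfun) o\<^sub>L A) - (((B o\<^sub>L A) - id_blinfun) o\<^sub>L (R o\<^sub>L A))"
    by (simp add: compose_simps compose_assoc compose_id)
  also have "\<dots> \<in> compact_ops P"
    by (intro compact_ops_add compact_ops_diff proj_ops_compact_left proj_ops_compact_right
        proj_ops_compose A B R)
  finally show ?thesis
    using R by blast
qed

text \<open>
  Every element of the coset of \<open>B\<close> is a left inverse of \<open>A\<close> modulo \<open>compact_ops P\<close>, so the lower
  bound on \<open>mu_tilde P A\<close> applies to all of them and hence to the coset norm. It also shows that
  \<open>mu_tilde P A\<close> is positive, so the upper bound can be divided by it.
\<close>

lemma mu_tilde_eq_inverse_coset_norm: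
  assumes A: "A \<in> proj_ops P" and B: "B \<in> proj_ops P"
    and BA: "(B o\<^sub>L A) - id_blinfun \<in> compact_ops P" and AB: "(A o\<^sub>L B) - id_blinfun \<in> compact_ops P"
  shows "0 < mu_tilde P A" and "mu_tilde P A = inverse (coset_norm (op_coset P B))"
proof -
  have ge: "1 \<le> norm C * mu_tilde P A" if C: "C - B \<in> compact_ops P" for C
  proof (rule mu_tilde_lower_bound)
    have "(C o\<^sub>L A) - id_blinfun = ((C - B) o\<^sub>L A) + ((B o\<^sub>L A) - id_blinfun)"
      by (simp add: compose_simps)
    also have "\<dots> \<in> compact_ops P"
      by (intro compact_ops_add proj_ops_compact_right A C BA)
    finally show "(C o\<^sub>L A) - id_blinfun \<in> compact_ops P" .
  qed
  from mu_tilde_lower_bound[OF BA] mu_tilde_nonneg[of A] show pos: "0 < mu_tilde P A"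
    by (cases "mu_tilde P A = 0") auto
  have "1 / mu_tilde P A \<le> coset_norm (op_coset P B)"
    using ge pos by (intro coset_norm_greatest) (simp add: field_simps)
  then have "coset_norm (op_coset P B) * mu_tilde P A = 1"
    using coset_norm_upper_bound[OF A B AB] pos by (simp add: field_simps)
  then show "mu_tilde P A = inverse (coset_norm (op_coset P B))"
    using inverse_unique by metis
qed

end

theorem theorem5p18:
  fixes P :: "nat \<Rightarrow> ('a::complex_hilbert_space \<Rightarrow>\<^sub>L 'a)"
    and A :: "'a \<Rightarrow>\<^sub>L 'a"
  assumes "happi_space P" and "A \<in> proj_ops P"
  shows "mu P A = inv_norm_recip P (op_coset P A) \<and>
    (mu P A > 0 \<longrightarrow> mu_tilde P A = mu_tilde P (hilbert_adjoint A))"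
proof -
  interpret happi P by unfold_locales (fact assms(1))
  note A = assms(2)
  show ?thesis
  proof (cases "op_coset P A \<in> Units (quot_ring P)")
    case True
    then obtain B where B: "B \<in> proj_ops P"
      and BA: "(B o\<^sub>L A) - id_blinfun \<in> compact_ops P" and AB: "(A o\<^sub>L B) - id_blinfun \<in> compact_ops P"
      using quot_ring_Units_iff[OF A] by blast
    have "mu_tilde P A = inverse (coset_norm (op_coset P B))"
      by (rule mu_tilde_eq_inverse_coset_norm(2)[OF A B BA AB])
    moreover have "mu_tilde P (hilbert_adjoint A) = inverse (coset_norm (op_coset P B))"
      using mu_tilde_eq_inverse_coset_norm(2)[OF proj_ops_adjoint[OF A] proj_ops_adjoint[OF B]
          mod_compact_ops_adjoint[OF B A AB] mod_compact_ops_adjoint[OF A B BA]]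
      by (simp add: coset_norm_adjoint proj_ops_bounded_ops[OF B])
    ultimately show ?thesis
      using True by (simp add: mu_def inv_norm_recip_def quot_ring_inv[OF A B BA AB])
  next
    case False
    then have "\<not> (0 < mu_tilde P A \<and> 0 < mu_tilde P (hilbert_adjoint A))"
      using two_sided_inverse_mod_compact_ops[OF A] quot_ring_Units_iff[OF A] by blast
    then have "mu P A = 0"
      using mu_tilde_nonneg[of A] mu_tilde_nonneg[of "hilbert_adjoint A"]
      by (auto simp: mu_def min_def)
    then show ?thesis
      using False by (simp add: inv_norm_recip_def)
  qed
qed

end
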